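(* Let $\delta=b-c$. The mixing time of the logit dynamics for the $2\times2$ coordination game is $\Theta(e^{\delta\beta})$ for every $\beta\ge 0$. That is, there exist constants $C_1,C_2>0$ such that for all $a,b,c,d\in\mathbb{R}$ with $a>d$, $b>c$ and $a-d\ge b-c$, and all $\beta\ge 0$, the mixing time $t_{\mathrm{mix}}$ of the logit dynamics with inverse noise $\beta$ for the coordination game with parameters $a,b,c,d$ satisfies $$C_1e^{\delta\beta}\le t_{\mathrm{mix}}\le C_2e^{\delta\beta}.$$
   Context: Coordination game with parameters $a,b,c,d$: two players, each with strategies $0$ and $1$, and payoffs (first player, second player): $(a,a)$ at profile $(0,0)$, $(c,d)$ at $(0,1)$, $(d,c)$ at $(1,0)$, $(b,b)$ at $(1,1)$. Logit dynamics: for a strategic game with $n$ players, finite strategy sets $S_i$ and utilities $u_i:\prod_j S_j\to\mathbb{R}$, and for $\beta\ge 0$, let $\sigma_i(y\mid\mathbf{x})=e^{\beta u_i(\mathbf{x}_{-i},y)}/\sum_{z\in S_i}e^{\beta u_i(\mathbf{x}_{-i},z)}$, where $(\mathbf{x}_{-i},y)$ is $\mathbf{x}$ with its $i$-th entry replaced by $y$. The logit dynamics with inverse noise $\beta$ is the Markov chain on $\Omega=\prod_j S_j$ which, from profile $\mathbf{x}$, selects a player $i$ uniformly at random and replaces $x_i$ by $y\in S_i$ with probability $\sigma_i(y\mid\mathbf{x})$. It is irreducible and aperiodic; let $P$ be its transition matrix and $\pi$ its unique stationary distribution. The mixing time is $t_{\mathrm{mix}}=\min\{t\in\mathbb{N}:\max_{\mathbf{x}\in\Omega}\|P^t(\mathbf{x},\cdot)-\pi\|_{\mathrm{TV}}\le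 1/4\}$, where $\|\mu-\nu\|_{\mathrm{TV}}=\max_{A\subseteq\Omega}|\mu(A)-\nu(A)|$. *)

theory Defs
  imports Complex_Main "HOL-Library.FuncSet"
begin

section \<open>Finite Markov chains\<close>

text \<open>A chain on a finite state space \<open>\<Omega>\<close> is given by its transition matrix
  \<open>P :: 'x \<Rightarrow> 'x \<Rightarrow> real\<close>; only the entries with both indices in \<open>\<Omega>\<close> matter.\<close>

primrec chain_power :: "'x set \<Rightarrow> ('x \<Rightarrow> 'x \<Rightarrow> real) \<Rightarrow> nat \<Rightarrow> 'x \<Rightarrow> 'x \<Rightarrow> real" where
  "chain_power \<Omega> P 0 x y = (if x = y then 1 else 0)"
| "chain_power \<Omega> P (Suc t) x y = (\<Sum>z\<in>\<Omega>. chain_power \<Omega> P t x z * P z y)"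

text \<open>Distributions vanish off \<open>\<Omega>\<close>, so that a stationary distribution that is unique on \<open>\<Omega>\<close>
  is unique as a function and \<open>THE\<close> below denotes it.\<close>

definition is_stationary :: "'x set \<Rightarrow> ('x \<Rightarrow> 'x \<Rightarrow> real) \<Rightarrow> ('x \<Rightarrow> real) \<Rightarrow> bool" where
  "is_stationary \<Omega> P \<pi> \<longleftrightarrow>
     (\<forall>x\<in>\<Omega>. 0 \<le> \<pi> x) \<and> (\<forall>x. x \<notin> \<Omega> \<longrightarrow> \<pi> x = 0) \<and> (\<Sum>x\<in>\<Omega>. \<pi> x) = 1 \<and>
     (\<forall>y\<in>\<Omega>. (\<Sum>x\<in>\<Omega>. \<pi> x * P x y) = \<pi> y)"

definition stationary_distribution :: "'x set \<Rightarrow> ('x \<Rightarrow> 'x \<Rightarrow> real) \<Rightarrow> 'x \<Rightarrow> real" where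
  "stationary_distribution \<Omega> P = (THE \<pi>. is_stationary \<Omega> P \<pi>)"

definition tv_dist :: "'x set \<Rightarrow> ('x \<Rightarrow> real) \<Rightarrow> ('x \<Rightarrow> real) \<Rightarrow> real" where
  "tv_dist \<Omega> \<mu> \<nu> = (MAX A\<in>Pow \<Omega>. \<bar>(\<Sum>x\<in>A. \<mu> x) - (\<Sum>x\<in>A. \<nu> x)\<bar>)"

definition mixing_time :: "'x set \<Rightarrow> ('x \<Rightarrow> 'x \<Rightarrow> real) \<Rightarrow> nat" where
  "mixing_time \<Omega> P =
     (LEAST t. (MAX x\<in>\<Omega>. tv_dist \<Omega> (chain_power \<Omega> P t x) (stationary_distribution \<Omega> P)) \<le> 1 / 4)"

section \<open>Logit dynamics\<close>

text \<open>The players are \<open>0, \<dots>, n - 1\<close>, player \<open>i\<close> has the finite nonempty strategy set \<open>S i\<close> and the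
  utility function \<open>u i\<close>. For \<open>i < n\<close> and \<open>y \<in> S i\<close>, the profile \<open>x(i := y)\<close> is again in
  \<open>profiles n S\<close>.\<close>

definition profiles :: "nat \<Rightarrow> (nat \<Rightarrow> 's set) \<Rightarrow> (nat \<Rightarrow> 's) set" where
  "profiles n S = (\<Pi>\<^sub>E i\<in>{..<n}. S i)"

definition logit_prob ::
  "(nat \<Rightarrow> 's set) \<Rightarrow> (nat \<Rightarrow> (nat \<Rightarrow> 's) \<Rightarrow> real) \<Rightarrow> real \<Rightarrow> nat \<Rightarrow> (nat \<Rightarrow> 's) \<Rightarrow> 's \<Rightarrow> real" where
  "logit_prob S u \<beta> i x y =
     exp (\<beta> * u i (x(i := y))) / (\<Sum>z\<in>S i. exp (\<beta> * u i (x(i := z))))"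

definition logit_matrix ::
  "nat \<Rightarrow> (nat \<Rightarrow> 's set) \<Rightarrow> (nat \<Rightarrow> (nat \<Rightarrow> 's) \<Rightarrow> real) \<Rightarrow> real
     \<Rightarrow> (nat \<Rightarrow> 's) \<Rightarrow> (nat \<Rightarrow> 's) \<Rightarrow> real" where
  "logit_matrix n S u \<beta> x x' =
     (\<Sum>i<n. 1 / real n * (\<Sum>y\<in>S i. if x(i := y) = x' then logit_prob S u \<beta> i x y else 0))"

definition logit_mixing_time ::
  "nat \<Rightarrow> (nat \<Rightarrow> 's set) \<Rightarrow> (nat \<Rightarrow> (nat \<Rightarrow> 's) \<Rightarrow> real) \<Rightarrow> real \<Rightarrow> nat" where
  "logit_mixing_time n S u \<beta> = mixing_time (profiles n S) (logit_matrix n S u \<beta>)"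

section \<open>The two-player coordination game\<close>

definition coordination_strategies :: "nat \<Rightarrow> nat set" where
  "coordination_strategies i = {0, 1}"

definition coordination_payoffs ::
  "real \<Rightarrow> real \<Rightarrow> real \<Rightarrow> real \<Rightarrow> nat \<Rightarrow> nat \<Rightarrow> real \<times> real" where
  "coordination_payoffs a b c d s t =
     (if s = 0 then (if t = 0 then (a, a) else (c, d))
      else (if t = 0 then (d, c) else (b, b)))"

definition coordination_utility ::
  "real \<Rightarrow> real \<Rightarrow> real \<Rightarrow> real \<Rightarrow> nat \<Rightarrow> (nat \<Rightarrow> nat) \<Rightarrow> real" where
  "coordination_utility a b c d i x =
     (if i = 0 then fst (coordination_payoffs a b c d (x 0) (x 1))
      else snd (coordination_payoffs a b c d (x 0) (x 1)))"

definition coordination_mixing_time :: "real \<Rightarrow> real \<Rightarrow> real \<Rightarrow> real \<Rightarrow> real \<Rightarrow> nat" where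
  "coordination_mixing_time a b c d \<beta> =
     logit_mixing_time 2 coordination_strategies (coordination_utility a b c d) \<beta>"

end

theory Submission
  imports Defs
begin

text \<open>Let \<open>p\<close> and \<open>q\<close> be the probabilities that a player leaves the equilibrium \<open>(0,0)\<close>
  respectively \<open>(1,1)\<close> when selected; then \<open>p \<le> q \<le> 1/2\<close> and \<open>1/q = 1 + exp (\<delta> * \<beta>)\<close>.
  The transition matrix has eigenvalues \<open>1\<close>, \<open>\<lambda> = 1 - (p + q) / 2\<close>, \<open>1 - \<lambda>\<close> and \<open>0\<close>, so its powers
  are explicit and the distance to stationarity is at most of order \<open>\<lambda> ^ t\<close>, which gives the upper
  bound. For the lower bound, the chain stays at \<open>(1,1)\<close> for \<open>t\<close> steps with probability
  \<open>(1 - q) ^ t \<ge> 1 - t * q\<close>, whereas \<open>(1,1)\<close> has stationary probability at most \<open>1/2\<close>.\<close>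

section \<open>Mixing times of finite chains\<close>

lemma chain_power_nonneg:
  assumes "\<And>x y. x \<in> \<Omega> \<Longrightarrow> y \<in> \<Omega> \<Longrightarrow> 0 \<le> P x y" "x \<in> \<Omega>" "y \<in> \<Omega>"
  shows "0 \<le> chain_power \<Omega> P t x y"
  using assms(2,3) by (induction t arbitrary: y) (auto intro!: sum_nonneg mult_nonneg_nonneg assms(1))

text \<open>The path that never moves contributes \<open>P x x ^ t\<close>, and every other path has
  nonnegative weight.\<close>

lemma holding_power_le_chain_power:
  assumes "finite \<Omega>" "\<And>x y. x \<in> \<Omega> \<Longrightarrow> y \<in> \<Omega> \<Longrightarrow> 0 \<le> P x y" "x \<in> \<Omega>"
  shows "P x x ^ t \<le> chain_power \<Omega> P t x x"
proof (induction t)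
  case (Suc t)
  have "P x x ^ Suc t \<le> chain_power \<Omega> P t x x * P x x"
    using mult_right_mono[OF Suc assms(2)[OF assms(3,3)]] by (simp add: mult.commute)
  also have "\<dots> \<le> (\<Sum>z\<in>\<Omega>. chain_power \<Omega> P t x z * P z x)"
    using assms by (intro member_le_sum) (auto intro!: mult_nonneg_nonneg chain_power_nonneg)
  finally show ?case by simp
qed simp

lemma diff_le_tv_dist:
  assumes "finite \<Omega>" "A \<subseteq> \<Omega>"
  shows "\<bar>(\<Sum>x\<in>A. \<mu> x) - (\<Sum>x\<in>A. \<nu> x)\<bar> \<le> tv_dist \<Omega> \<mu> \<nu>"
  unfolding tv_dist_def using assms by (intro Max_ge) auto

lemma tv_dist_le_l1:
  assumes "finite \<Omega>"
  shows "tv_dist \<Omega> \<mu> \<nu> \<le> (\<Sum>x\<in>\<Omega>. \<bar>\<mu> x - \<nu> x\<bar>)"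
proof -
  have "\<bar>(\<Sum>x\<in>A. \<mu> x) - (\<Sum>x\<in>A. \<nu> x)\<bar> \<le> (\<Sum>x\<in>\<Omega>. \<bar>\<mu> x - \<nu> x\<bar>)" if "A \<subseteq> \<Omega>" for A
  proof -
    have "\<bar>(\<Sum>x\<in>A. \<mu> x) - (\<Sum>x\<in>A. \<nu> x)\<bar> \<le> (\<Sum>x\<in>A. \<bar>\<mu> x - \<nu> x\<bar>)"
      by (simp add: sum_subtractf[symmetric])
    also have "\<dots> \<le> (\<Sum>x\<in>\<Omega>. \<bar>\<mu> x - \<nu> x\<bar>)"
      using that assms by (intro sum_mono2) auto
    finally show ?thesis .
  qed
  moreover have "Pow \<Omega> \<noteq> {}" by blast
  ultimately show ?thesis
    unfolding tv_dist_def using assms by (subst Max_le_iff) auto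
qed

lemma mixing_time_le:
  assumes "finite \<Omega>" "\<Omega> \<noteq> {}"
    and "\<And>x. x \<in> \<Omega> \<Longrightarrow> tv_dist \<Omega> (chain_power \<Omega> P t x) (stationary_distribution \<Omega> P) \<le> 1 / 4"
  shows "mixing_time \<Omega> P \<le> t"
  unfolding mixing_time_def using assms by (intro Least_le) (subst Max_le_iff, auto)

text \<open>The hypothesis on \<open>t\<close> ensures that \<open>LEAST\<close> is taken over a nonempty set.\<close>

lemma tv_dist_at_mixing_time:
  assumes "finite \<Omega>" "x \<in> \<Omega>"
    and "\<And>x. x \<in> \<Omega> \<Longrightarrow> tv_dist \<Omega> (chain_power \<Omega> P t x) (stationary_distribution \<Omega> P) \<le> 1 / 4"
  shows "tv_dist \<Omega> (chain_power \<Omega> P (mixing_time \<Omega> P) x) (stationary_distribution \<Omega> P) \<le> 1 / 4"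
proof -
  let ?D = "\<lambda>t. MAX x\<in>\<Omega>. tv_dist \<Omega> (chain_power \<Omega> P t x) (stationary_distribution \<Omega> P)"
  have "?D t \<le> 1 / 4" using assms by (subst Max_le_iff) auto
  then have "?D (mixing_time \<Omega> P) \<le> 1 / 4"
    unfolding mixing_time_def by (rule LeastI)
  then show ?thesis using assms(1,2) by (subst (asm) Max_le_iff) auto
qed

section \<open>Two-player profiles\<close>

text \<open>The restriction gives \<open>undefined\<close> from index 2 on, as membership in the
  extensional product \<open>profiles 2\<close> demands.\<close>

definition profile :: "nat \<Rightarrow> nat \<Rightarrow> nat \<Rightarrow> nat" where
  "profile s t = (\<lambda>i\<in>{..<2}. if i = 0 then s else t)"

lemma profile_nth [simp]: "profile s t 0 = s" "profile s t 1 = t" "profile s t (Suc 0) = t"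
  by (auto simp: profile_def)

lemma profile_eq_iff [simp]: "profile s t = profile s' t' \<longleftrightarrow> s = s' \<and> t = t'"
  by (metis profile_nth(1,2))

lemma profile_upd [simp]:
  "(profile s t)(0 := y) = profile y t" "(profile s t)(Suc 0 := y) = profile s y"
  by (auto simp: profile_def restrict_def fun_eq_iff)

abbreviation coordination_profiles :: "(nat \<Rightarrow> nat) set" where
  "coordination_profiles \<equiv> profiles 2 coordination_strategies"

lemma coordination_profiles_eq:
  "coordination_profiles = {profile 0 0, profile 0 1, profile 1 0, profile 1 1}"
proof (intro equalityI subsetI)
  fix x assume x: "x \<in> coordination_profiles"
  then have "x = profile (x 0) (x 1)"
    by (auto simp: profiles_def profile_def fun_eq_iff PiE_def extensional_def less_2_cases_iff)
  moreover have "x 0 \<in> {0, 1}" "x 1 \<in> {0, 1}"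
    using x by (auto simp: profiles_def coordination_strategies_def PiE_def Pi_def)
  ultimately show "x \<in> {profile 0 0, profile 0 1, profile 1 0, profile 1 1}"
    by (metis insertE insertI1 insertI2 singletonD)
next
  fix x assume "x \<in> {profile 0 0, profile 0 1, profile 1 0, profile 1 1}"
  then show "x \<in> coordination_profiles"
    unfolding profiles_def coordination_strategies_def profile_def
    by (elim insertE emptyE) (auto intro!: restrict_PiE_iff[THEN iffD2])
qed

lemma finite_coordination_profiles [simp]: "finite coordination_profiles"
  by (simp add: coordination_profiles_eq)

lemma sum_coordination_profiles:
  "sum f coordination_profiles =
     f (profile 0 0) + f (profile 0 1) + f (profile 1 0) + (f (profile 1 1) :: real)"
  by (simp add: coordination_profiles_eq add.assoc)

text \<open>The value 0 off the state space matches \<open>is_stationary\<close>, so that stationary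
  vectors can be compared as functions.\<close>

definition profile_vec :: "real \<Rightarrow> real \<Rightarrow> real \<Rightarrow> real \<Rightarrow> (nat \<Rightarrow> nat) \<Rightarrow> real" where
  "profile_vec w00 w01 w10 w11 x =
     (if x \<in> coordination_profiles then
        (if x 0 = 0 then (if x 1 = 0 then w00 else w01) else (if x 1 = 0 then w10 else w11))
      else 0)"

lemma profile_vec_simps:
  "profile_vec w00 w01 w10 w11 (profile 0 0) = w00" "profile_vec w00 w01 w10 w11 (profile 0 1) = w01"
  "profile_vec w00 w01 w10 w11 (profile 1 0) = w10" "profile_vec w00 w01 w10 w11 (profile 1 1) = w11"
  by (auto simp: profile_vec_def coordination_profiles_eq)

lemmas profile_vec_Suc [simp] = profile_vec_simps[unfolded One_nat_def]

lemma profiles_cases: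
  assumes "x \<in> coordination_profiles"
  obtains "x = profile 0 0" | "x = profile 0 1" | "x = profile 1 0" | "x = profile 1 1"
  using assms by (auto simp: coordination_profiles_eq)

text \<open>Selecting a player keeps the other entry fixed, so each summand belongs to one player.
  Both occur on the diagonal.\<close>

lemma logit_matrix_profile:
  assumes "s' \<in> {0, 1}" "t' \<in> {0, 1}"
  shows "logit_matrix 2 coordination_strategies u \<beta> (profile s t) (profile s' t') =
     (if t = t' then logit_prob coordination_strategies u \<beta> 0 (profile s t) s' / 2 else 0)
     + (if s = s' then logit_prob coordination_strategies u \<beta> 1 (profile s t) t' / 2 else 0)"
  using assms
  by (auto simp: logit_matrix_def coordination_strategies_def lessThan_nat_numeral numeral_2_eq_2 lessThan_Suc)

section \<open>The chain of the coordination game\<close>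

text \<open>All entries come from one response rule: against strategy 0 a player picks 1 with
  probability \<open>p\<close>, against strategy 1 it picks 0 with probability
  \<open>q\<close>.\<close>

locale coordination_chain =
  fixes P :: "(nat \<Rightarrow> nat) \<Rightarrow> (nat \<Rightarrow> nat) \<Rightarrow> real" and p q :: real
  assumes p_pos: "0 < p" and p_le_q: "p \<le> q" and q_le_half: "q \<le> 1 / 2"
    and P_from_00: "P (profile 0 0) (profile 0 0) = 1 - p" "P (profile 0 0) (profile 0 1) = p / 2"
      "P (profile 0 0) (profile 1 0) = p / 2" "P (profile 0 0) (profile 1 1) = 0"
    and P_from_01: "P (profile 0 1) (profile 0 0) = (1 - p) / 2"
      "P (profile 0 1) (profile 0 1) = (p + q) / 2"
      "P (profile 0 1) (profile 1 0) = 0" "P (profile 0 1) (profile 1 1) = (1 - q) / 2"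
    and P_from_10: "P (profile 1 0) (profile 0 0) = (1 - p) / 2" "P (profile 1 0) (profile 0 1) = 0"
      "P (profile 1 0) (profile 1 0) = (p + q) / 2" "P (profile 1 0) (profile 1 1) = (1 - q) / 2"
    and P_from_11: "P (profile 1 1) (profile 0 0) = 0" "P (profile 1 1) (profile 0 1) = q / 2"
      "P (profile 1 1) (profile 1 0) = q / 2" "P (profile 1 1) (profile 1 1) = 1 - q"
begin

section \<open>Eigenvectors and powers of the transition matrix\<close>

lemmas P_entries = P_from_00 P_from_01 P_from_10 P_from_11

lemmas P_entries_Suc = P_entries[unfolded One_nat_def]

lemma q_pos: "0 < q"
  using p_pos p_le_q by linarith

text \<open>The weights are proportional to \<open>1/p - 1\<close>, 1, 1, \<open>1/q - 1\<close>;
  for the game this is the Gibbs measure with weights \<open>exp ((a - d) * \<beta>)\<close>, 1, 1,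
  \<open>exp ((b - c) * \<beta>)\<close>.\<close>

definition stat :: "(nat \<Rightarrow> nat) \<Rightarrow> real" where
  "stat = profile_vec (q * (1 - p) / (p + q)) (p * q / (p + q)) (p * q / (p + q)) (p * (1 - q) / (p + q))"

definition rate :: real where
  "rate = 1 - (p + q) / 2"

definition left_eigvec :: "(nat \<Rightarrow> nat) \<Rightarrow> real" where
  "left_eigvec = profile_vec (1 - p) ((p - q) / 2) ((p - q) / 2) (q - 1)"

text \<open>Scaled so that its pairing with \<open>left_eigvec\<close> is \<open>rate\<close>
  instead of 1; hence \<open>rate ^ t\<close> appears at time \<open>Suc t\<close>.\<close>

definition right_eigvec :: "(nat \<Rightarrow> nat) \<Rightarrow> real" where
  "right_eigvec = profile_vec (p / (p + q)) ((p - q) / (2 * (p + q))) ((p - q) / (2 * (p + q))) (- q / (p + q))"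

text \<open>Antisymmetric under exchange of the players; both a left and a right eigenvector, for
  the eigenvalue \<open>1 - rate\<close>.\<close>

definition swap_eigvec :: "(nat \<Rightarrow> nat) \<Rightarrow> real" where
  "swap_eigvec = profile_vec 0 1 (- 1) 0"

lemmas eigvec_defs = stat_def rate_def left_eigvec_def right_eigvec_def swap_eigvec_def

lemma P_nonneg: "x \<in> coordination_profiles \<Longrightarrow> y \<in> coordination_profiles \<Longrightarrow> 0 \<le> P x y"
  using p_pos p_le_q q_le_half
  by (elim profiles_cases) (simp_all add: P_entries_Suc)

lemma stat_mult_P:
  assumes "y \<in> coordination_profiles"
  shows "(\<Sum>x\<in>coordination_profiles. stat x * P x y) = stat y"
  using assms p_pos q_pos
  by (elim profiles_cases)
     (simp_all add: sum_coordination_profiles P_entries_Suc stat_def divide_simps, simp_all add: algebra_simps)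

lemma left_eigvec_mult_P:
  assumes "y \<in> coordination_profiles"
  shows "(\<Sum>x\<in>coordination_profiles. left_eigvec x * P x y) = rate * left_eigvec y"
  using assms
  by (elim profiles_cases)
     (simp_all add: sum_coordination_profiles P_entries_Suc left_eigvec_def rate_def field_simps)

lemma swap_eigvec_mult_P:
  assumes "y \<in> coordination_profiles"
  shows "(\<Sum>x\<in>coordination_profiles. swap_eigvec x * P x y) = (1 - rate) * swap_eigvec y"
  using assms
  by (elim profiles_cases)
     (simp_all add: sum_coordination_profiles P_entries_Suc swap_eigvec_def rate_def field_simps)

text \<open>The rank-one terms belong to the eigenvalues 1 (constant right eigenvector),
  \<open>rate\<close> and \<open>1 - rate\<close>. The division by 2 normalises
  \<open>swap_eigvec\<close>, whose pairing with itself is 2.\<close>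

lemma P_spectral:
  assumes "x \<in> coordination_profiles" "y \<in> coordination_profiles"
  shows "P x y = stat y + right_eigvec x * left_eigvec y + (1 - rate) * (swap_eigvec x * swap_eigvec y / 2)"
  using assms p_pos q_pos
  by (elim profiles_cases)
     (simp_all add: P_entries_Suc eigvec_defs divide_simps, simp_all add: algebra_simps)

text \<open>The fourth eigenvalue is \<open>0\<close>, so that the expansion starts at \<open>t = 1\<close>.\<close>

lemma chain_power_spectral:
  assumes "x \<in> coordination_profiles" "y \<in> coordination_profiles"
  shows "chain_power coordination_profiles P (Suc t) x y =
    stat y + rate ^ t * (right_eigvec x * left_eigvec y)
    + (1 - rate) ^ Suc t * (swap_eigvec x * swap_eigvec y / 2)"
  using assms(2)
proof (induction t arbitrary: y)
  case 0
  have "chain_power coordination_profiles P (Suc 0) x y = P x y"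
    using assms(1) by (simp add: if_distrib[of "\<lambda>c. c * _"] cong: if_cong)
  then show ?case using P_spectral[OF assms(1) 0] by simp
next
  case (Suc t)
  \<comment> \<open>Multiplication by \<open>P\<close> from the right acts only on the factors
    indexed by \<open>z\<close>, and these are left eigenvectors.\<close>
  have "chain_power coordination_profiles P (Suc (Suc t)) x y =
    (\<Sum>z\<in>coordination_profiles. stat z * P z y
       + rate ^ t * right_eigvec x * (left_eigvec z * P z y)
       + (1 - rate) ^ Suc t * swap_eigvec x / 2 * (swap_eigvec z * P z y))"
    by (subst chain_power.simps, intro sum.cong refl, subst Suc.IH) (auto simp: field_simps)
  also have "\<dots> = stat y + rate ^ t * right_eigvec x * (rate * left_eigvec y)
       + (1 - rate) ^ Suc t * swap_eigvec x / 2 * ((1 - rate) * swap_eigvec y)"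
    using Suc.prems
    by (simp only: sum.distrib sum_distrib_left[symmetric] stat_mult_P left_eigvec_mult_P swap_eigvec_mult_P)
  finally show ?case by simp
qed

section \<open>Existence and uniqueness of the stationary distribution\<close>

lemma is_stationary_stat: "is_stationary coordination_profiles P stat"
proof -
  have "0 \<le> stat x" if "x \<in> coordination_profiles" for x
    using that p_pos q_pos p_le_q q_le_half by (elim profiles_cases) (simp_all add: stat_def)
  moreover have "stat x = 0" if "x \<notin> coordination_profiles" for x
    using that by (simp add: stat_def profile_vec_def)
  moreover have "(\<Sum>x\<in>coordination_profiles. stat x) = 1"
    using p_pos q_pos
    by (simp add: sum_coordination_profiles stat_def divide_simps) (simp add: algebra_simps)
  ultimately show ?thesis
    unfolding is_stationary_def using stat_mult_P by blast
qed

lemma is_stationary_unique: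
  assumes "is_stationary coordination_profiles P \<nu>"
  shows "\<nu> = stat"
proof
  fix x
  let ?x = "\<nu> (profile 0 0)" and ?y = "\<nu> (profile 0 1)" and ?z = "\<nu> (profile 1 0)"
    and ?w = "\<nu> (profile 1 1)"
  have inv: "\<And>y. y \<in> coordination_profiles \<Longrightarrow> (\<Sum>x\<in>coordination_profiles. \<nu> x * P x y) = \<nu> y"
    and total: "?x + ?y + ?z + ?w = 1"
    and off: "\<And>x. x \<notin> coordination_profiles \<Longrightarrow> \<nu> x = 0"
    using assms by (auto simp: is_stationary_def sum_coordination_profiles)
  have e00: "2 * p * ?x = (1 - p) * (?y + ?z)"
    using inv[of "profile 0 0"]
    by (simp add: sum_coordination_profiles P_entries_Suc coordination_profiles_eq field_simps)
  have e11: "2 * q * ?w = (1 - q) * (?y + ?z)"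
    using inv[of "profile 1 1"]
    by (simp add: sum_coordination_profiles P_entries_Suc coordination_profiles_eq field_simps)
  \<comment> \<open>The balance equations at the two miscoordinated profiles have the same inflow
    from the equilibria; subtracting cancels it.\<close>
  have "?y * (2 - p - q) = ?z * (2 - p - q)"
    using inv[of "profile 0 1"] inv[of "profile 1 0"]
    by (simp add: sum_coordination_profiles P_entries_Suc coordination_profiles_eq field_simps)
  moreover have "2 - p - q \<noteq> 0" using p_le_q q_le_half by linarith
  ultimately have yz: "?y = ?z" by simp
  \<comment> \<open>The factor \<open>2 * p * q\<close> lets \<open>e00\<close> and
    \<open>e11\<close> express the total mass through \<open>?z\<close> alone.\<close>
  have "2 * p * q * 1 = 2 * p * q * (?x + ?y + ?z + ?w)" using total by simp
  also have "\<dots> = q * (2 * p * ?x) + p * (2 * q * ?w) + 2 * p * q * (?y + ?z)"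
    by (simp add: algebra_simps)
  also have "\<dots> = 2 * (p + q) * ?z"
    unfolding e00 e11 yz by (simp add: algebra_simps)
  finally have z: "?z = p * q / (p + q)" using p_pos q_pos by (simp add: field_simps)
  have "p * ?x = (1 - p) * ?z"
    using e00 unfolding yz by (simp add: algebra_simps)
  then have "p * ?x = p * (q * (1 - p) / (p + q))"
    unfolding z by (simp add: mult_ac)
  moreover have "q * ?w = (1 - q) * ?z"
    using e11 unfolding yz by (simp add: algebra_simps)
  then have "q * ?w = q * (p * (1 - q) / (p + q))"
    unfolding z by (simp add: mult_ac)
  ultimately have "?x = q * (1 - p) / (p + q)" "?w = p * (1 - q) / (p + q)"
    using p_pos q_pos by (simp_all only: mult_cancel_left) auto
  then show "\<nu> x = stat x"
    using yz z off[of x]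
    by (cases "x \<in> coordination_profiles") (auto simp: stat_def profile_vec_def elim!: profiles_cases)
qed

lemma stationary_distribution_eq: "stationary_distribution coordination_profiles P = stat"
  unfolding stationary_distribution_def
  using is_stationary_stat is_stationary_unique by (rule the_equality)

section \<open>Upper bound on the mixing time\<close>

lemma tv_dist_chain_power_le:
  assumes "x \<in> coordination_profiles"
  shows "tv_dist coordination_profiles (chain_power coordination_profiles P (Suc t) x) stat \<le> 6 * rate ^ t"
proof -
  \<comment> \<open>This makes \<open>rate\<close> dominate the other nontrivial eigenvalue
    \<open>1 - rate\<close>.\<close>
  have "1 / 2 \<le> rate"
    using p_le_q q_le_half by (simp add: rate_def field_simps)
  moreover have "rate \<le> 1"
    using p_pos q_pos by (simp add: rate_def)
  ultimately have rate: "0 \<le> 1 - rate" "1 - rate \<le> rate" "rate \<le> 1" "0 \<le> rate"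
    by simp_all
  have pow: "(1 - rate) ^ Suc t \<le> rate ^ t"
  proof -
    have "(1 - rate) ^ Suc t \<le> rate ^ Suc t" using rate by (intro power_mono) auto
    also have "\<dots> \<le> rate ^ t" using rate by (intro power_decreasing) auto
    finally show ?thesis .
  qed
  have right: "\<bar>right_eigvec x\<bar> \<le> 1"
    using assms p_pos p_le_q
    by (elim profiles_cases) (simp_all add: right_eigvec_def abs_if field_simps)
  have left: "\<bar>left_eigvec y\<bar> \<le> 1" if "y \<in> coordination_profiles" for y
    using that p_pos p_le_q q_le_half
    by (elim profiles_cases) (simp_all add: left_eigvec_def abs_if field_simps)
  have swap: "\<bar>swap_eigvec y\<bar> \<le> 1" if "y \<in> coordination_profiles" for y
    using that by (elim profiles_cases) (simp_all add: swap_eigvec_def)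
  \<comment> \<open>The \<open>rate\<close> term contributes 1 and the halved swap term 1/2; summing
    over four states then gives the constant 6.\<close>
  have "\<bar>chain_power coordination_profiles P (Suc t) x y - stat y\<bar> \<le> 3 / 2 * rate ^ t"
    if y: "y \<in> coordination_profiles" for y
  proof -
    have "\<bar>chain_power coordination_profiles P (Suc t) x y - stat y\<bar>
      \<le> \<bar>rate ^ t * (right_eigvec x * left_eigvec y)\<bar>
        + \<bar>(1 - rate) ^ Suc t * (swap_eigvec x * swap_eigvec y / 2)\<bar>"
      unfolding chain_power_spectral[OF assms y] by linarith
    also have "\<dots> = rate ^ t * (\<bar>right_eigvec x\<bar> * \<bar>left_eigvec y\<bar>)
        + (1 - rate) ^ Suc t * (\<bar>swap_eigvec x\<bar> * \<bar>swap_eigvec y\<bar> / 2)"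
      using rate(1,4) by (simp add: abs_mult del: power_Suc)
    also have "\<dots> \<le> rate ^ t * 1 + rate ^ t * (1 / 2)"
      using rate pow right left[OF y] swap[OF assms] swap[OF y]
      by (intro add_mono mult_mono divide_right_mono mult_le_one) auto
    finally show ?thesis by simp
  qed
  then have "(\<Sum>y\<in>coordination_profiles. \<bar>chain_power coordination_profiles P (Suc t) x y - stat y\<bar>)
      \<le> (\<Sum>y\<in>coordination_profiles. 3 / 2 * rate ^ t)"
    by (rule sum_mono)
  also have "\<dots> = 6 * rate ^ t"
    by (simp only: sum_coordination_profiles)
  finally show ?thesis
    using tv_dist_le_l1[OF finite_coordination_profiles] order_trans by blast
qed

lemma tv_dist_le_quarter:
  assumes "x \<in> coordination_profiles" "48 / q \<le> real t"
  shows "tv_dist coordination_profiles (chain_power coordination_profiles P (Suc t) x)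
    (stationary_distribution coordination_profiles P) \<le> 1 / 4"
proof -
  \<comment> \<open>Dropping \<open>p\<close> gives \<open>rate \<le> 1 - q / 2\<close>. With
    \<open>t \<ge> 48 / q\<close> the exponent reaches 24, and \<open>exp 24 \<ge> 24\<close>
    offsets the factor 6, leaving 1/4.\<close>
  have "rate \<le> exp (- (q / 2))"
    using exp_ge_add_one_self[of "- (q / 2)"] p_pos unfolding rate_def by (simp add: field_simps)
  then have "rate ^ t \<le> exp (- (q / 2)) ^ t"
    using p_le_q q_le_half by (intro power_mono) (auto simp: rate_def)
  also have "\<dots> = exp (- (real t * q / 2))"
    by (simp flip: exp_of_nat_mult)
  also have "\<dots> \<le> exp (- 24)"
    using assms(2) q_pos by (simp add: field_simps)
  also have "\<dots> \<le> 1 / 24"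
    using exp_ge_add_one_self[of 24] by (simp add: exp_minus field_simps)
  finally show ?thesis
    using tv_dist_chain_power_le[OF assms(1), of t] by (simp add: stationary_distribution_eq)
qed

text \<open>The summand 2 pays for rounding up \<open>48 / q\<close> and for the extra step in
  \<open>Suc t\<close>.\<close>

lemma mixing_time_upper: "real (mixing_time coordination_profiles P) \<le> 48 / q + 2"
proof -
  let ?t = "nat \<lceil>48 / q\<rceil>"
  have "48 / q \<le> real ?t" by (rule real_nat_ceiling_ge)
  then have "mixing_time coordination_profiles P \<le> Suc ?t"
    using tv_dist_le_quarter by (intro mixing_time_le) (auto simp: coordination_profiles_eq)
  moreover have "real ?t \<le> 48 / q + 1"
    using q_pos of_int_ceiling_le_add_one[of "48 / q"] by simp
  ultimately show ?thesis by linarith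
qed

section \<open>Lower bound on the mixing time\<close>

lemma mixing_time_lower: "1 / (4 * q) \<le> real (mixing_time coordination_profiles P)"
proof -
  let ?t = "mixing_time coordination_profiles P" and ?x = "profile 1 1"
  have x: "?x \<in> coordination_profiles" by (simp add: coordination_profiles_eq)
  have "1 - real ?t * q \<le> (1 - q) ^ ?t"
    using Bernoulli_inequality[of "- q" ?t] q_le_half by simp
  also have "\<dots> \<le> chain_power coordination_profiles P ?t ?x ?x"
    using holding_power_le_chain_power[where P = P, OF finite_coordination_profiles P_nonneg x, where t = ?t]
    by (simp add: P_entries_Suc)
  also have "\<dots> \<le> 1 / 4 + stat ?x"
  proof -
    \<comment> \<open>The time from the upper bound witnesses that the \<open>LEAST\<close> in the
      mixing time is attained.\<close>
    have "tv_dist coordination_profiles (chain_power coordination_profiles P ?t ?x) stat \<le> 1 / 4"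
      using tv_dist_at_mixing_time[OF finite_coordination_profiles x
          tv_dist_le_quarter[OF _ real_nat_ceiling_ge]]
      by (simp add: stationary_distribution_eq)
    then show ?thesis
      using diff_le_tv_dist[of coordination_profiles "{?x}" "chain_power coordination_profiles P ?t ?x" stat] x
      by simp
  qed
  \<comment> \<open>Here \<open>p \<le> q\<close> enters: (1,1) is the equilibrium of smaller
    weight. The chain of bounds becomes \<open>1 - ?t * q \<le> 3/4\<close>.\<close>
  also have "stat ?x \<le> 1 / 2"
  proof -
    have "p * (1 - q) \<le> p"
      using p_pos q_pos by (simp add: mult_le_cancel_left1)
    then have "p * (1 - q) * 2 \<le> p + q"
      using p_le_q by linarith
    then show ?thesis
      using p_pos q_pos by (simp add: stat_def field_simps)
  qed
  finally show ?thesis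
    using q_pos by (simp add: field_simps)
qed

end

section \<open>Identification of the logit dynamics with the abstract chain\<close>

lemma coordination_chain_logit:
  fixes a b c d \<beta> :: real
  assumes "b - c \<le> a - d" "0 \<le> (b - c) * \<beta>" "0 \<le> \<beta>"
  shows "coordination_chain (logit_matrix 2 coordination_strategies (coordination_utility a b c d) \<beta>)
    (1 / (1 + exp ((a - d) * \<beta>))) (1 / (1 + exp ((b - c) * \<beta>)))"
proof -
  let ?L = "logit_prob coordination_strategies (coordination_utility a b c d) \<beta>"
  let ?p = "1 / (1 + exp ((a - d) * \<beta>))" and ?q = "1 / (1 + exp ((b - c) * \<beta>))"
  \<comment> \<open>A logit choice between two options depends only on the payoff difference. The
    four forms cover both orders of summation in the denominator.\<close>
  have odds: "exp (\<beta> * u) / (exp (\<beta> * u) + exp (\<beta> * v)) = 1 / (1 + exp ((v - u) * \<beta>))"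
    "exp (\<beta> * v) / (exp (\<beta> * u) + exp (\<beta> * v)) = 1 - 1 / (1 + exp ((v - u) * \<beta>))"
    "exp (\<beta> * u) / (exp (\<beta> * v) + exp (\<beta> * u)) = 1 / (1 + exp ((v - u) * \<beta>))"
    "exp (\<beta> * v) / (exp (\<beta> * v) + exp (\<beta> * u)) = 1 - 1 / (1 + exp ((v - u) * \<beta>))" for u v
    using exp_gt_zero[of "\<beta> * u"] exp_gt_zero[of "\<beta> * v"]
    by (simp_all add: algebra_simps exp_diff add_pos_pos divide_simps)
       (smt (verit) exp_gt_zero)+
  \<comment> \<open>For either player, strategies 0 and 1 earn \<open>a\<close> and \<open>d\<close>
    against 0, and \<open>c\<close> and \<open>b\<close> against 1.\<close>
  have L: "?L 0 (profile s 0) 1 = ?p" "?L 0 (profile s 0) 0 = 1 - ?p"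
    "?L 0 (profile s 1) 0 = ?q" "?L 0 (profile s 1) 1 = 1 - ?q"
    "?L 1 (profile 0 s) 1 = ?p" "?L 1 (profile 0 s) 0 = 1 - ?p"
    "?L 1 (profile 1 s) 0 = ?q" "?L 1 (profile 1 s) 1 = 1 - ?q" for s
    using odds[where u = d and v = a] odds[where u = c and v = b]
    by (simp_all add: logit_prob_def coordination_strategies_def coordination_utility_def
        coordination_payoffs_def)
  have "(b - c) * \<beta> \<le> (a - d) * \<beta>" using assms by (simp add: mult_right_mono)
  then have "?p \<le> ?q" by (intro divide_left_mono) (auto simp: add_pos_pos)
  moreover have "?q \<le> 1 / 2" using assms(2) by (intro divide_left_mono) (auto simp: add_pos_pos)
  moreover have "0 < ?p" by (simp add: add_pos_pos)
  ultimately show ?thesis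
    by unfold_locales (simp_all only: logit_matrix_profile insertI1 insertI2 L if_True if_False refl
        zero_neq_one one_neq_zero, simp_all add: add_divide_distrib)
qed

theorem theorem9:
  "\<exists>C\<^sub>1 C\<^sub>2 :: real. C\<^sub>1 > 0 \<and> C\<^sub>2 > 0 \<and>
     (\<forall>a b c d \<beta> \<delta> :: real.
        a > d \<and> b > c \<and> a - d \<ge> b - c \<and> \<beta> \<ge> 0 \<and> \<delta> = b - c \<longrightarrow>
          C\<^sub>1 * exp (\<delta> * \<beta>) \<le> real (coordination_mixing_time a b c d \<beta>) \<and>
          real (coordination_mixing_time a b c d \<beta>) \<le> C\<^sub>2 * exp (\<delta> * \<beta>))"
proof (rule exI[of _ "1 / 4"], rule exI[of _ 98], intro conjI allI impI)
  fix a b c d \<beta> \<delta> :: real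
  assume asm: "a > d \<and> b > c \<and> a - d \<ge> b - c \<and> \<beta> \<ge> 0 \<and> \<delta> = b - c"
  then have E: "1 \<le> exp (\<delta> * \<beta>)" by simp
  interpret coordination_chain "logit_matrix 2 coordination_strategies (coordination_utility a b c d) \<beta>"
    "1 / (1 + exp ((a - d) * \<beta>))" "1 / (1 + exp (\<delta> * \<beta>))"
    using asm coordination_chain_logit[of b c a d \<beta>] by simp
  \<comment> \<open>Here \<open>1 / (4 * q)\<close> equals
    \<open>(1 + exp (\<delta> * \<beta>)) / 4\<close>.\<close>
  show "1 / 4 * exp (\<delta> * \<beta>) \<le> real (coordination_mixing_time a b c d \<beta>)"
    using mixing_time_lower unfolding coordination_mixing_time_def logit_mixing_time_def by simp
  show "real (coordination_mixing_time a b c d \<beta>) \<le> 98 * exp (\<delta> * \<beta>)"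
  proof -
    have "real (coordination_mixing_time a b c d \<beta>) \<le> 48 * (1 + exp (\<delta> * \<beta>)) + 2"
      using mixing_time_upper unfolding coordination_mixing_time_def logit_mixing_time_def by simp
    \<comment> \<open>The constant part 48 + 2 is absorbed into
      \<open>50 * exp (\<delta> * \<beta>)\<close> by \<open>E\<close>.\<close>
    also have "\<dots> \<le> 98 * exp (\<delta> * \<beta>)"
      using E by (simp del: one_le_exp_iff)
    finally show ?thesis .
  qed
qed simp_all

end
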